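(* Let $n\ge2$, let $d_i$ be a metric on a nontrivial real vector space $X_i$, and let $f_i(u):=d_i(u,0_{X_i})$ for $u\in X_i$ $(i=1,\ldots,n)$. Let $p\in(1,\infty)$ and $q\in\mathbb{R}$ with $\frac1p+\frac1q=1$. Suppose that there exist distinct indices $i,j\in\{1,\ldots,n\}$ such that $f_i$ is positively homogeneous, $f_j$ is absolutely homogeneous, and $f_k$ is $2$-homogeneous for all $k\ne i,j$. If $f_1,\ldots,f_n$ satisfy the Clarkson inequality, then $$C_{\mathrm{NJ}}^{(\sigma)}(d_{\psi_p})=C_{\mathrm{NJ}}^{(\sigma)}(d_{\psi_q})=\begin{cases}2^{\frac{\sigma}{p}-\sigma+1}&\text{if }p\in(1,2]\text{ and }\sigma\in[p,q],\\2^{1-\frac{\sigma}{p}}&\text{if }p\in(2,\infty)\text{ and }\sigma\in[q,p].\end{cases}$$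
   Context: For $r\in[1,\infty)$, $d_{\psi_r}$ is the metric on $\mathrm{P}:=X_1\times\cdots\times X_n$ given, for $x=(x_1,\ldots,x_n)$, $y=(y_1,\ldots,y_n)$, by $d_{\psi_r}(x,y)=\left(\sum_{i=1}^nd_i(x_i,y_i)^r\right)^{1/r}$. For a metric $d$ on a real vector space $X$ with $f(x):=d(x,0_X)$ and $f^\sigma(x):=(f(x))^\sigma$, the von Neumann-Jordan constant of order $\sigma\in[1,\infty)$ is $$C_{\mathrm{NJ}}^{(\sigma)}(d):=\sup_{(x,y)\ne(0_X,0_X)}\frac{f^\sigma(x+y)+f^\sigma(x-y)}{2^{\sigma-1}(f^\sigma(x)+f^\sigma(y))}\in(0,\infty].$$ For $\alpha\in(1,2]$ and $\beta\in\mathbb{R}$ with $\frac1\alpha+\frac1\beta=1$, $d$ (equivalently, $f$) satisfies the $(\alpha,\beta)$-Clarkson inequality if $f^\beta(x+y)+f^\beta(x-y)\le2\left(f^\alpha(x)+f^\alpha(y)\right)^{\beta/\alpha}$ for all $x,y\in X$. It satisfies the Clarkson inequality if it satisfies the $(\alpha,\beta)$-Clarkson inequality for every $\alpha\in(1,2]$ and $\beta\in\mathbb{R}$ with $\frac1\alpha+\frac1\beta=1$. A function $f$ on $X$ is: positively homogeneous if $f(\lambda x)=\lambda f(x)$ for all $x\in X$, $\lambda\ge0$; absolutely homogeneous if $f(\lambda x)=|\lambda|f(x)$ for all $x\in X$, $\lambda\in\mathbb{R}$; $2$-homogeneous if $f(2x)=2f(x)$ for all $x\in X$. No translation-invariance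 or continuity of the vector space operations is assumed. *)

theory Defs
  imports "HOL-Analysis.Analysis"
begin

text \<open>
  A real vector space is rendered as a linear subspace \<open>X\<close> of a type of class
  \<open>real_vector\<close>, so that a family of different spaces fits into one type. No generality is
  lost, since the members of any family of real vector spaces embed into their direct sum.
  A metric on \<open>X\<close> is a function with \<open>Metric_space X d\<close>; it need not be related to the
  linear structure. That locale asks for nonnegativity and symmetry also outside \<open>X\<close>, which
  any metric on \<open>X\<close> satisfies once it is extended by \<open>0\<close>.
\<close>

definition dist_zero :: "('a::real_vector \<Rightarrow> 'a \<Rightarrow> real) \<Rightarrow> 'a \<Rightarrow> real" where
  "dist_zero d u = d u 0"

definition positively_homogeneous_on :: "'a::real_vector set \<Rightarrow> ('a \<Rightarrow> real) \<Rightarrow> bool" where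
  "positively_homogeneous_on X f \<longleftrightarrow> (\<forall>x\<in>X. \<forall>c\<ge>0. f (c *\<^sub>R x) = c * f x)"

definition absolutely_homogeneous_on :: "'a::real_vector set \<Rightarrow> ('a \<Rightarrow> real) \<Rightarrow> bool" where
  "absolutely_homogeneous_on X f \<longleftrightarrow> (\<forall>x\<in>X. \<forall>c. f (c *\<^sub>R x) = \<bar>c\<bar> * f x)"

definition two_homogeneous_on :: "'a::real_vector set \<Rightarrow> ('a \<Rightarrow> real) \<Rightarrow> bool" where
  "two_homogeneous_on X f \<longleftrightarrow> (\<forall>x\<in>X. f (2 *\<^sub>R x) = 2 * f x)"

definition clarkson_on :: "real \<Rightarrow> real \<Rightarrow> 'a::real_vector set \<Rightarrow> ('a \<Rightarrow> real) \<Rightarrow> bool" where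
  "clarkson_on \<alpha> \<beta> X f \<longleftrightarrow>
     (\<forall>x\<in>X. \<forall>y\<in>X. f (x + y) powr \<beta> + f (x - y) powr \<beta>
        \<le> 2 * (f x powr \<alpha> + f y powr \<alpha>) powr (\<beta> / \<alpha>))"

definition satisfies_clarkson_on :: "'a::real_vector set \<Rightarrow> ('a \<Rightarrow> real) \<Rightarrow> bool" where
  "satisfies_clarkson_on X f \<longleftrightarrow>
     (\<forall>\<alpha> \<beta>. 1 < \<alpha> \<and> \<alpha> \<le> 2 \<and> 1 / \<alpha> + 1 / \<beta> = 1 \<longrightarrow> clarkson_on \<alpha> \<beta> X f)"

text \<open>
  The supremum is taken in the extended reals, as it may be infinite. When \<open>d\<close> is a metric on
  \<open>X\<close>, the denominator is positive for every admissible pair.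
\<close>

definition C_NJ :: "real \<Rightarrow> 'a::real_vector set \<Rightarrow> ('a \<Rightarrow> 'a \<Rightarrow> real) \<Rightarrow> ereal" where
  "C_NJ \<sigma> X d =
     (SUP (x, y) \<in> X \<times> X - {(0, 0)}.
        ereal ((dist_zero d (x + y) powr \<sigma> + dist_zero d (x - y) powr \<sigma>) /
               (2 powr (\<sigma> - 1) * (dist_zero d x powr \<sigma> + dist_zero d y powr \<sigma>))))"

text \<open>
  The product of the spaces \<open>X i\<close>, as a subspace of \<open>'a ^ 'n\<close>; the number of factors is
  \<open>CARD('n)\<close>.
\<close>

definition prod_space :: "('n::finite \<Rightarrow> 'a set) \<Rightarrow> ('a ^ 'n) set" where
  "prod_space X = {x. \<forall>i. x $ i \<in> X i}"

definition psi_dist ::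
  "real \<Rightarrow> ('n::finite \<Rightarrow> 'a \<Rightarrow> 'a \<Rightarrow> real) \<Rightarrow> 'a ^ 'n \<Rightarrow> 'a ^ 'n \<Rightarrow> real" where
  "psi_dist r d x y = (\<Sum>i\<in>UNIV. d i (x $ i) (y $ i) powr r) powr (1 / r)"

lemma subspace_prod_space:
  fixes X :: "'n::finite \<Rightarrow> 'a::real_vector set"
  assumes "\<And>i. subspace (X i)"
  shows "subspace (prod_space X)"
  using assms unfolding subspace_def prod_space_def by simp

end

theory Submission imports Defs begin

text \<open>
  By symmetry in \<open>p\<close> and \<open>q\<close> let \<open>t \<le> 2 \<le> s\<close> be the two conjugate exponents and
  \<open>\<sigma> \<in> [t, s]\<close>. Minkowski's inequality with exponent \<open>s / t\<close> lifts the \<open>(t, s)\<close>-Clarkson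
  inequality from the factors to the product, for the \<open>\<ell>\<^sup>s\<close> and the \<open>\<ell>\<^sup>t\<close> combination alike.
  Comparing power means of orders \<open>t \<le> \<sigma> \<le> s\<close> then gives
  \<open>F\<^sup>\<sigma>(x + y) + F\<^sup>\<sigma>(x - y) \<le> 2 powr (\<sigma> / t) (F\<^sup>\<sigma>(x) + F\<^sup>\<sigma>(y))\<close>, the upper bound. For unit
  vectors \<open>u\<close>, \<open>v\<close> in the factors \<open>i\<close>, \<open>j\<close> it is attained at \<open>(u, 0), (0, v)\<close> in the
  \<open>\<ell>\<^sup>t\<close> case and at \<open>(u, v), (u, -v)\<close> in the \<open>\<ell>\<^sup>s\<close> case.
\<close>

section \<open>Convexity, Minkowski's inequality and power means\<close>

lemma powr_convex_combination:
  fixes x y l p :: real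
  assumes "1 \<le> p" "0 \<le> x" "0 \<le> y" "0 \<le> l" "l \<le> 1"
  shows "(l * x + (1 - l) * y) powr p \<le> l * x powr p + (1 - l) * y powr p"
proof -
  \<comment> \<open>When one of the two points is \<open>0\<close>, the claim reduces to
    \<open>m powr p \<le> m\<close> for a weight \<open>m\<close> in the unit interval; interior
    points are covered by convexity.\<close>
  have scale: "(m * z) powr p \<le> m * z powr p" if "0 \<le> m" "m \<le> 1" for m z :: real
  proof (cases "m = 0")
    case False
    then have "m powr p \<le> m" using that assms(1) by (intro powr_le_one_le) auto
    then show ?thesis by (simp add: powr_mult mult_right_mono)
  qed simp
  consider "x = 0" | "y = 0" | "0 < x" "0 < y" using assms by linarith
  then show ?thesis
  proof cases
    case 1
    then show ?thesis using scale[of "1 - l" y] assms by simp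
  next
    case 2
    then show ?thesis using scale[of l x] assms by simp
  next
    case 3
    then show ?thesis
      using convex_onD[OF powr_convex[OF assms(1)], of l y x] assms
      by (simp add: add.commute)
  qed
qed

text \<open>With \<open>A\<close> and \<open>B\<close> the norms of \<open>a\<close> and
  \<open>b\<close>, the vector \<open>a + b\<close> is \<open>A + B\<close> times the convex
  combination of \<open>a / A\<close> and \<open>b / B\<close> with weight
  \<open>l = A / (A + B)\<close>. Convexity in each coordinate, summed up, bounds the sum of p-th
  powers by \<open>(A + B) powr p\<close>.\<close>

lemma Minkowski_inequality_sum:
  fixes a b :: "'i \<Rightarrow> real"
  assumes p: "1 \<le> p" and I: "finite I"
    and a: "\<And>i. i \<in> I \<Longrightarrow> 0 \<le> a i" and b: "\<And>i. i \<in> I \<Longrightarrow> 0 \<le> b i"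
  shows "(\<Sum>i\<in>I. (a i + b i) powr p) powr (1 / p)
    \<le> (\<Sum>i\<in>I. a i powr p) powr (1 / p) + (\<Sum>i\<in>I. b i powr p) powr (1 / p)"
proof -
  define A where "A = (\<Sum>i\<in>I. a i powr p) powr (1 / p)"
  define B where "B = (\<Sum>i\<in>I. b i powr p) powr (1 / p)"
  have Ap: "A powr p = (\<Sum>i\<in>I. a i powr p)" and Bp: "B powr p = (\<Sum>i\<in>I. b i powr p)"
    using p by (simp_all add: A_def B_def powr_powr sum_nonneg)
  \<comment> \<open>Normalising fails if \<open>A\<close> or \<open>B\<close> is \<open>0\<close>;
    then the corresponding vector vanishes on \<open>I\<close> and both sides agree.\<close>
  have zero: "\<forall>i\<in>I. c i = 0" if "(\<Sum>i\<in>I. c i powr p) powr (1 / p) = 0" for c :: "'i \<Rightarrow> real"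
    using that I by (simp add: sum_nonneg_eq_0_iff)
  have "A \<ge> 0" "B \<ge> 0" by (simp_all add: A_def B_def)
  then consider "A = 0" | "B = 0" | "0 < A" "0 < B" by linarith
  then have "(\<Sum>i\<in>I. (a i + b i) powr p) powr (1 / p) \<le> A + B"
  proof cases
    case 1
    then have "\<forall>i\<in>I. a i = 0" using zero unfolding A_def by blast
    then have "(\<Sum>i\<in>I. (a i + b i) powr p) = (\<Sum>i\<in>I. b i powr p)" by simp
    then show ?thesis using 1 by (simp add: B_def)
  next
    case 2
    then have "\<forall>i\<in>I. b i = 0" using zero unfolding B_def by blast
    then have "(\<Sum>i\<in>I. (a i + b i) powr p) = (\<Sum>i\<in>I. a i powr p)" by simp
    then show ?thesis using 2 by (simp add: A_def)
  next
    case 3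
    define l where "l = A / (A + B)"
    have l: "0 \<le> l" "l \<le> 1" "1 - l = B / (A + B)"
      using 3 by (simp_all add: l_def field_simps)
    have term_le: "(a i + b i) powr p
      \<le> (A + B) powr p * (l * (a i powr p / A powr p) + (1 - l) * (b i powr p / B powr p))"
      if i: "i \<in> I" for i
    proof -
      have "a i + b i = (A + B) * (l * (a i / A) + (1 - l) * (b i / B))"
        unfolding l(3) using 3 by (simp add: l_def add_nonneg_eq_0_iff distrib_left)
      then have "(a i + b i) powr p
          = (A + B) powr p * (l * (a i / A) + (1 - l) * (b i / B)) powr p"
        by (simp add: powr_mult)
      also have "\<dots> \<le> (A + B) powr p * (l * (a i / A) powr p + (1 - l) * (b i / B) powr p)"
        using p l 3 a[OF i] b[OF i] by (intro mult_left_mono powr_convex_combination) auto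
      finally show ?thesis by (simp add: powr_divide)
    qed
    have "(\<Sum>i\<in>I. (a i + b i) powr p)
        \<le> (\<Sum>i\<in>I. (A + B) powr p * (l * (a i powr p / A powr p) + (1 - l) * (b i powr p / B powr p)))"
      by (intro sum_mono term_le)
    also have "\<dots> = (A + B) powr p
        * (l * ((\<Sum>i\<in>I. a i powr p) / A powr p) + (1 - l) * ((\<Sum>i\<in>I. b i powr p) / B powr p))"
      by (simp add: sum_distrib_left[symmetric] sum.distrib sum_divide_distrib[symmetric])
    also have "\<dots> = (A + B) powr p" using 3 by (simp add: Ap[symmetric] Bp[symmetric])
    finally have "(\<Sum>i\<in>I. (a i + b i) powr p) powr (1 / p) \<le> ((A + B) powr p) powr (1 / p)"
      using p by (intro powr_mono2) (auto intro: sum_nonneg)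
    also have "\<dots> = A + B" using p 3 by (simp add: powr_powr)
    finally show ?thesis .
  qed
  then show ?thesis by (simp add: A_def B_def)
qed

text \<open>This is the triangle inequality for finitely many vectors \<open>(a i, b i)\<close> in
  the plane with the p-norm. Induction reduces it to two vectors, which is
  \<open>Minkowski_inequality_sum\<close> over the index set \<open>bool\<close>.\<close>

lemma Minkowski_inequality_pair:
  fixes a b :: "'i \<Rightarrow> real"
  assumes p: "1 \<le> p" and I: "finite I"
    and "\<And>i. i \<in> I \<Longrightarrow> 0 \<le> a i" and "\<And>i. i \<in> I \<Longrightarrow> 0 \<le> b i"
  shows "((\<Sum>i\<in>I. a i) powr p + (\<Sum>i\<in>I. b i) powr p) powr (1 / p)
    \<le> (\<Sum>i\<in>I. (a i powr p + b i powr p) powr (1 / p))"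
  using I assms(3,4)
proof (induction I rule: finite_induct)
  case (insert k I)
  have two: "((u + u') powr p + (v + v') powr p) powr (1 / p)
      \<le> (u powr p + v powr p) powr (1 / p) + (u' powr p + v' powr p) powr (1 / p)"
    if "0 \<le> u" "0 \<le> v" "0 \<le> u'" "0 \<le> v'" for u v u' v' :: real
    using Minkowski_inequality_sum[OF p, of "UNIV :: bool set" "\<lambda>c. if c then u else v"
        "\<lambda>c. if c then u' else v'"] that
    by (simp add: UNIV_bool add.commute)
  have "((\<Sum>i\<in>insert k I. a i) powr p + (\<Sum>i\<in>insert k I. b i) powr p) powr (1 / p)
      \<le> (a k powr p + b k powr p) powr (1 / p)
        + ((\<Sum>i\<in>I. a i) powr p + (\<Sum>i\<in>I. b i) powr p) powr (1 / p)"
    using insert by (simp add: two sum_nonneg)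
  also have "\<dots> \<le> (\<Sum>i\<in>insert k I. (a i powr p + b i powr p) powr (1 / p))"
    using insert by simp
  finally show ?case .
qed simp

text \<open>Convexity of the power \<open>b / a\<close> at the midpoint of \<open>x powr a\<close>
  and \<open>y powr a\<close>, followed by the b-th root.\<close>

lemma power_mean_mono:
  fixes x y a b :: real
  assumes "0 < a" "a \<le> b"
  shows "((x powr a + y powr a) / 2) powr (1 / a) \<le> ((x powr b + y powr b) / 2) powr (1 / b)"
proof -
  have "((x powr a + y powr a) / 2) powr (b / a) \<le> (x powr b + y powr b) / 2"
    using powr_convex_combination[of "b / a" "x powr a" "y powr a" "1 / 2"] assms
    by (simp add: powr_powr add_divide_distrib)
  then have "(((x powr a + y powr a) / 2) powr (b / a)) powr (1 / b)
      \<le> ((x powr b + y powr b) / 2) powr (1 / b)"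
    using assms by (intro powr_mono2) auto
  then show ?thesis using assms by (simp add: powr_powr)
qed

section \<open>Clarkson's inequality in the product\<close>

text \<open>The s-th power of the combined function is a plain sum over the factors, so the
  factorwise inequalities add up at once; Minkowski's inequality is then applied to the right-hand
  side.\<close>

lemma clarkson_on_prod_space_upper:
  fixes X :: "'n::finite \<Rightarrow> 'a::real_vector set"
  assumes ts: "0 < t" "t \<le> s" and f: "\<And>k. clarkson_on t s (X k) (f k)"
  shows "clarkson_on t s (prod_space X) (\<lambda>x. (\<Sum>k\<in>UNIV. f k (x $ k) powr s) powr (1 / s))"
  unfolding clarkson_on_def
proof (intro ballI)
  fix x y assume xy: "x \<in> prod_space X" "y \<in> prod_space X"
  let ?N = "\<lambda>x. \<Sum>k\<in>UNIV. f k (x $ k) powr s"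
  let ?M = "\<Sum>k\<in>UNIV. (f k (x $ k) powr t + f k (y $ k) powr t) powr (s / t)"
  have "?N (x + y) + ?N (x - y)
      \<le> (\<Sum>k\<in>UNIV. 2 * (f k (x $ k) powr t + f k (y $ k) powr t) powr (s / t))"
    unfolding sum.distrib[symmetric] using f xy
    by (intro sum_mono) (simp add: clarkson_on_def prod_space_def)
  \<comment> \<open>\<open>?M powr (t / s)\<close> is the norm of order \<open>s / t\<close> of the
    sum of the vectors \<open>f k (x $ k) powr t\<close> and
    \<open>f k (y $ k) powr t\<close>.\<close>
  also have "\<dots> = 2 * (?M powr (t / s)) powr (s / t)"
    using ts by (simp add: powr_powr sum_distrib_left sum_nonneg)
  also have "\<dots> \<le> 2 * (?N x powr (t / s) + ?N y powr (t / s)) powr (s / t)"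
  proof -
    have "?M powr (t / s) \<le> ?N x powr (t / s) + ?N y powr (t / s)"
      using Minkowski_inequality_sum[of "s / t" UNIV "\<lambda>k. f k (x $ k) powr t"
          "\<lambda>k. f k (y $ k) powr t"] ts
      by (simp add: powr_powr)
    then show ?thesis using ts by (intro mult_left_mono powr_mono2) auto
  qed
  finally show "(?N (x + y) powr (1 / s)) powr s + (?N (x - y) powr (1 / s)) powr s
      \<le> 2 * ((?N x powr (1 / s)) powr t + (?N y powr (1 / s)) powr t) powr (s / t)"
    using ts by (simp add: powr_powr sum_nonneg)
qed

text \<open>Here the right-hand side is additive over the factors, so the order is reversed:
  Minkowski's inequality first splits the left-hand side into factors, and the Clarkson inequality
  is then used in each summand.\<close>

lemma clarkson_on_prod_space_lower:
  fixes X :: "'n::finite \<Rightarrow> 'a::real_vector set"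
  assumes ts: "0 < t" "t \<le> s" and f: "\<And>k. clarkson_on t s (X k) (f k)"
  shows "clarkson_on t s (prod_space X) (\<lambda>x. (\<Sum>k\<in>UNIV. f k (x $ k) powr t) powr (1 / t))"
  unfolding clarkson_on_def
proof (intro ballI)
  fix x y assume xy: "x \<in> prod_space X" "y \<in> prod_space X"
  let ?N = "\<lambda>x. \<Sum>k\<in>UNIV. f k (x $ k) powr t"
  let ?L = "?N (x + y) powr (s / t) + ?N (x - y) powr (s / t)"
  have "?L powr (t / s)
      \<le> (\<Sum>k\<in>UNIV. (f k (x $ k + y $ k) powr s + f k (x $ k - y $ k) powr s) powr (t / s))"
    using Minkowski_inequality_pair[of "s / t" UNIV "\<lambda>k. f k (x $ k + y $ k) powr t"
        "\<lambda>k. f k (x $ k - y $ k) powr t"] ts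
    by (simp add: powr_powr)
  also have "\<dots> \<le> (\<Sum>k\<in>UNIV. 2 powr (t / s) * (f k (x $ k) powr t + f k (y $ k) powr t))"
  proof (rule sum_mono)
    fix k
    have "(f k (x $ k + y $ k) powr s + f k (x $ k - y $ k) powr s) powr (t / s)
        \<le> (2 * (f k (x $ k) powr t + f k (y $ k) powr t) powr (s / t)) powr (t / s)"
      using f xy ts by (intro powr_mono2) (simp_all add: clarkson_on_def prod_space_def)
    then show "(f k (x $ k + y $ k) powr s + f k (x $ k - y $ k) powr s) powr (t / s)
        \<le> 2 powr (t / s) * (f k (x $ k) powr t + f k (y $ k) powr t)"
      using ts by (simp add: powr_mult powr_powr)
  qed
  also have "\<dots> = 2 powr (t / s) * (?N x + ?N y)"
    by (simp add: sum_distrib_left[symmetric] sum.distrib)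
  finally have "(?L powr (t / s)) powr (s / t) \<le> (2 powr (t / s) * (?N x + ?N y)) powr (s / t)"
    using ts by (intro powr_mono2) auto
  then have "?L \<le> 2 * (?N x + ?N y) powr (s / t)"
    using ts by (simp add: powr_mult powr_powr)
  then show "(?N (x + y) powr (1 / t)) powr s + (?N (x - y) powr (1 / t)) powr s
      \<le> 2 * ((?N x powr (1 / t)) powr t + (?N y powr (1 / t)) powr t) powr (s / t)"
    using ts by (simp add: powr_powr sum_nonneg)
qed

text \<open>With \<open>m r\<close> the power mean of order \<open>r\<close>, the Clarkson
  inequality says that \<open>m s (x + y) (x - y)\<close> is at most
  \<open>2 powr (1 / t) * m t x y\<close>. Raising \<open>t\<close> to \<open>\<sigma>\<close> on
  the right and lowering \<open>s\<close> to \<open>\<sigma>\<close> on the left preserves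
  it.\<close>

lemma clarkson_on_imp_powr_le:
  assumes ts: "0 < t" "t \<le> \<sigma>" "\<sigma> \<le> s" and f: "clarkson_on t s X f" "x \<in> X" "y \<in> X"
  shows "f (x + y) powr \<sigma> + f (x - y) powr \<sigma> \<le> 2 powr (\<sigma> / t) * (f x powr \<sigma> + f y powr \<sigma>)"
proof -
  define m where "m r u v = ((f u powr r + f v powr r) / 2) powr (1 / r)" for r u v
  have pow: "m r u v powr r = (f u powr r + f v powr r) / 2" if "0 < r" for r u v
    using that by (simp add: m_def powr_powr)
  have "m \<sigma> (x + y) (x - y) \<le> m s (x + y) (x - y)"
    unfolding m_def using ts by (intro power_mean_mono) auto
  also have "\<dots> \<le> ((f x powr t + f y powr t) powr (s / t)) powr (1 / s)"
  proof -
    have "f (x + y) powr s + f (x - y) powr s \<le> 2 * (f x powr t + f y powr t) powr (s / t)"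
      using f by (auto simp: clarkson_on_def)
    then show ?thesis unfolding m_def using ts by (intro powr_mono2) auto
  qed
  \<comment> \<open>The Clarkson factor 2 has cancelled the half in the mean of order
    \<open>s\<close>. The 2 inserted here completes the mean of order \<open>t\<close>, and its root
    is the constant \<open>2 powr (1 / t)\<close>.\<close>
  also have "\<dots> = (2 * ((f x powr t + f y powr t) / 2)) powr (1 / t)"
    using ts by (simp add: powr_powr del: distrib_left_numeral)
  also have "\<dots> = 2 powr (1 / t) * m t x y"
    unfolding m_def by (simp only: powr_mult)
  also have "\<dots> \<le> 2 powr (1 / t) * m \<sigma> x y"
    unfolding m_def using ts by (intro mult_left_mono power_mean_mono) auto
  finally have "m \<sigma> (x + y) (x - y) powr \<sigma> \<le> (2 powr (1 / t) * m \<sigma> x y) powr \<sigma>"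
    using ts by (intro powr_mono2) (auto simp: m_def)
  then show ?thesis
    using ts by (simp add: powr_mult powr_powr pow field_simps)
qed

section \<open>Bounding the von Neumann-Jordan constant\<close>

lemma C_NJ_le_of_clarkson_on:
  assumes ts: "0 < t" "t \<le> \<sigma>" "\<sigma> \<le> s" and c: "clarkson_on t s X (dist_zero d)"
    and pos: "\<And>x. x \<in> X \<Longrightarrow> x \<noteq> 0 \<Longrightarrow> dist_zero d x \<noteq> 0"
  shows "C_NJ \<sigma> X d \<le> ereal (2 powr (\<sigma> / t - \<sigma> + 1))"
proof -
  let ?f = "dist_zero d"
  have "(?f (x + y) powr \<sigma> + ?f (x - y) powr \<sigma>) / (2 powr (\<sigma> - 1) * (?f x powr \<sigma> + ?f y powr \<sigma>))
      \<le> 2 powr (\<sigma> / t - \<sigma> + 1)"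
    if "x \<in> X" "y \<in> X" "(x, y) \<noteq> (0, 0)" for x y
  proof -
    have "0 < ?f x powr \<sigma> + ?f y powr \<sigma>"
      using pos[of x] pos[of y] that by (auto simp: add_pos_nonneg add_nonneg_pos)
    then have "0 < 2 powr (\<sigma> - 1) * (?f x powr \<sigma> + ?f y powr \<sigma>)" by simp
    moreover have "2 powr (\<sigma> / t - \<sigma> + 1) * 2 powr (\<sigma> - 1) = 2 powr (\<sigma> / t)"
      by (simp add: powr_add[symmetric])
    ultimately show ?thesis
      using clarkson_on_imp_powr_le[OF ts c that(1,2)]
      by (simp add: pos_divide_le_eq mult.assoc[symmetric])
  qed
  then show ?thesis unfolding C_NJ_def by (intro SUP_least) force
qed

lemma C_NJ_ge:
  assumes "x \<in> X" "y \<in> X" "(x, y) \<noteq> (0, 0)"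
    and "c = (dist_zero d (x + y) powr \<sigma> + dist_zero d (x - y) powr \<sigma>) /
               (2 powr (\<sigma> - 1) * (dist_zero d x powr \<sigma> + dist_zero d y powr \<sigma>))"
  shows "ereal c \<le> C_NJ \<sigma> X d"
  unfolding C_NJ_def using assms by (intro SUP_upper2[of "(x, y)"]) auto

section \<open>Special vectors under the product metrics\<close>

lemma dist_zero_psi_dist:
  "dist_zero (psi_dist r d) = (\<lambda>x. (\<Sum>k\<in>UNIV. dist_zero (d k) (x $ k) powr r) powr (1 / r))"
  by (simp add: fun_eq_iff dist_zero_def psi_dist_def)

lemma dist_zero_psi_dist_neq_0:
  fixes X :: "'n::finite \<Rightarrow> 'a::real_vector set"
  assumes "\<And>k. subspace (X k)" "\<And>k. Metric_space (X k) (d k)"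
    and x: "x \<in> prod_space X" "x \<noteq> 0"
  shows "dist_zero (psi_dist r d) x \<noteq> 0"
proof -
  obtain k where "x $ k \<noteq> 0" using x(2) by (auto simp: vec_eq_iff)
  then have "dist_zero (d k) (x $ k) \<noteq> 0"
    using x(1) Metric_space.zero[OF assms(2), of "x $ k" k 0] subspace_0[OF assms(1)]
    by (simp add: dist_zero_def prod_space_def)
  then have "(\<Sum>k\<in>UNIV. dist_zero (d k) (x $ k) powr r) \<noteq> 0"
    by (subst sum_nonneg_eq_0_iff) auto
  then show ?thesis by (simp add: dist_zero_psi_dist)
qed

text \<open>A nonzero vector is divided by its positive distance to \<open>0\<close>. The unit
  vectors so obtained build the extremal pairs.\<close>

lemma positively_homogeneous_on_unit_vector:
  assumes X: "subspace X" "X \<noteq> {0}" and d: "Metric_space X d"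
    and f: "positively_homogeneous_on X (dist_zero d)"
  obtains u where "u \<in> X" "dist_zero d u = 1"
proof -
  obtain w where w: "w \<in> X" "w \<noteq> 0" using X subspace_0 by fastforce
  then have "dist_zero d w \<noteq> 0"
    using Metric_space.zero[OF d, of w 0] subspace_0[OF X(1)] by (simp add: dist_zero_def)
  moreover have "0 \<le> dist_zero d w"
    using Metric_space.nonneg[OF d] by (simp add: dist_zero_def)
  ultimately have "dist_zero d ((1 / dist_zero d w) *\<^sub>R w) = 1"
    using f w(1) by (simp add: positively_homogeneous_on_def)
  then show ?thesis using that subspace_scale[OF X(1) w(1)] by blast
qed

lemma dist_zero_psi_dist_two:
  fixes a b :: "'a::real_vector"
  assumes ij: "i \<noteq> j" and zero: "\<And>k. dist_zero (d k) 0 = 0"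
  shows "dist_zero (psi_dist r d) (\<chi> k. if k = i then a else if k = j then b else 0)
    = (dist_zero (d i) a powr r + dist_zero (d j) b powr r) powr (1 / r)"
proof -
  have "(\<Sum>k\<in>UNIV. dist_zero (d k) (if k = i then a else if k = j then b else 0) powr r)
      = (\<Sum>k\<in>{i, j}. dist_zero (d k) (if k = i then a else if k = j then b else 0) powr r)"
    by (rule sum.mono_neutral_right) (auto simp: zero)
  then show ?thesis using ij by (simp add: dist_zero_psi_dist)
qed

section \<open>Attaining the bound\<close>

lemma C_NJ_psi_dist:
  fixes X :: "'n::finite \<Rightarrow> 'a::real_vector set"
  assumes X: "\<And>k. subspace (X k)" "\<And>k. X k \<noteq> {0}"
    and d: "\<And>k. Metric_space (X k) (d k)"
    and ts: "1 < t" "t \<le> 2" "1 / t + 1 / s = 1" and \<sigma>: "t \<le> \<sigma>" "\<sigma> \<le> s"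
    and ij: "i \<noteq> j"
    and fi: "positively_homogeneous_on (X i) (dist_zero (d i))"
    and fj: "absolutely_homogeneous_on (X j) (dist_zero (d j))"
    and cl: "\<And>k. satisfies_clarkson_on (X k) (dist_zero (d k))"
  shows "C_NJ \<sigma> (prod_space X) (psi_dist t d) = ereal (2 powr (\<sigma> / t - \<sigma> + 1))"
    and "C_NJ \<sigma> (prod_space X) (psi_dist s d) = ereal (2 powr (\<sigma> / t - \<sigma> + 1))"
proof -
  have le: "0 < t" "t \<le> s" "0 < s" using ts(1) \<sigma> by auto
  have cl': "clarkson_on t s (X k) (dist_zero (d k))" for k
    using cl[of k] ts by (simp add: satisfies_clarkson_on_def)
  have upper: "C_NJ \<sigma> (prod_space X) (psi_dist r d) \<le> ereal (2 powr (\<sigma> / t - \<sigma> + 1))"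
    if "clarkson_on t s (prod_space X) (dist_zero (psi_dist r d))" for r
    by (rule C_NJ_le_of_clarkson_on[OF le(1) \<sigma> that]) (rule dist_zero_psi_dist_neq_0[OF X(1) d])
  have zero: "dist_zero (d k) 0 = 0" for k
    using Metric_space.zero[OF d, of 0 k 0] subspace_0[OF X(1)] by (simp add: dist_zero_def)
  have "positively_homogeneous_on (X j) (dist_zero (d j))"
    using fj by (simp add: positively_homogeneous_on_def absolutely_homogeneous_on_def)
  then obtain v where v: "v \<in> X j" "dist_zero (d j) v = 1"
    using positively_homogeneous_on_unit_vector[OF X d] by blast
  obtain u where u: "u \<in> X i" "dist_zero (d i) u = 1"
    using positively_homogeneous_on_unit_vector[OF X d fi] by blast
  \<comment> \<open>All extremal vectors live in the coordinates \<open>i\<close> and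
    \<open>j\<close>; \<open>w a b\<close> carries \<open>a\<close> and \<open>b\<close> there and
    is \<open>0\<close> elsewhere.\<close>
  define w where "w a b = (\<chi> k. if k = i then a else if k = j then b else 0)" for a b :: 'a
  have w_in: "w a b \<in> prod_space X" if "a \<in> X i" "b \<in> X j" for a b
    using that subspace_0[OF X(1)] by (simp add: w_def prod_space_def)
  have w_add: "w a b + w a' b' = w (a + a') (b + b')" for a b a' b'
    by (simp add: w_def vec_eq_iff)
  have w_diff: "w a b - w a' b' = w (a - a') (b - b')" for a b a' b'
    by (simp add: w_def vec_eq_iff)
  have fw: "dist_zero (psi_dist r d) (w a b)
      = (dist_zero (d i) a powr r + dist_zero (d j) b powr r) powr (1 / r)" for r a b
    unfolding w_def by (rule dist_zero_psi_dist_two[where d = d, OF ij zero])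
  have u2: "dist_zero (d i) (u + u) = 2"
  proof -
    have "dist_zero (d i) (2 *\<^sub>R u) = 2"
      using fi u by (simp add: positively_homogeneous_on_def)
    then show ?thesis by (simp add: scaleR_2)
  qed
  have v2: "dist_zero (d j) (v + v) = 2"
  proof -
    have "dist_zero (d j) (2 *\<^sub>R v) = 2"
      using fj v by (simp add: absolutely_homogeneous_on_def)
    then show ?thesis by (simp add: scaleR_2)
  qed
  \<comment> \<open>Absolute homogeneity in factor \<open>j\<close> enters through the sign:
    \<open>- v\<close> is again a unit vector, and both extremal pairs use this.\<close>
  have vm: "dist_zero (d j) (- v) = 1"
    using fj[unfolded absolutely_homogeneous_on_def, rule_format, OF v(1), of "-1"] v(2) by simp
  have mv: "- v \<in> X j" using subspace_neg[OF X(1) v(1)] .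
  have nz: "w u b \<noteq> 0" for b
  proof
    assume "w u b = 0"
    then have "w u b $ i = 0" by simp
    then show False using u zero by (simp add: w_def)
  qed
  show "C_NJ \<sigma> (prod_space X) (psi_dist t d) = ereal (2 powr (\<sigma> / t - \<sigma> + 1))"
  proof (rule antisym)
    show "C_NJ \<sigma> (prod_space X) (psi_dist t d) \<le> ereal (2 powr (\<sigma> / t - \<sigma> + 1))"
      by (rule upper)
        (simp only: dist_zero_psi_dist clarkson_on_prod_space_lower[OF le(1,2) cl'])
    show "ereal (2 powr (\<sigma> / t - \<sigma> + 1)) \<le> C_NJ \<sigma> (prod_space X) (psi_dist t d)"
    \<comment> \<open>Both vectors have norm 1, while their sum \<open>w u v\<close> and difference
      \<open>w u (- v)\<close> have norm \<open>2 powr (1 / t)\<close>.\<close>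
    proof (rule C_NJ_ge[of "w u 0" _ "w 0 v"])
      show "2 powr (\<sigma> / t - \<sigma> + 1)
          = (dist_zero (psi_dist t d) (w u 0 + w 0 v) powr \<sigma>
              + dist_zero (psi_dist t d) (w u 0 - w 0 v) powr \<sigma>) /
            (2 powr (\<sigma> - 1) * (dist_zero (psi_dist t d) (w u 0) powr \<sigma>
              + dist_zero (psi_dist t d) (w 0 v) powr \<sigma>))"
        by (simp add: w_add w_diff fw u v vm zero powr_powr powr_add powr_diff)
    qed (use u v nz subspace_0[OF X(1)] in \<open>auto intro: w_in\<close>)
  qed
  have "\<sigma> / t - \<sigma> + 1 = 1 - \<sigma> / s"
  proof -
    have "\<sigma> * (1 / t + 1 / s) = \<sigma>" using ts(3) by simp
    then show ?thesis by (simp add: distrib_left)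
  qed
  moreover have "ereal (2 powr (1 - \<sigma> / s)) \<le> C_NJ \<sigma> (prod_space X) (psi_dist s d)"
  \<comment> \<open>Both vectors have norm \<open>2 powr (1 / s)\<close>, while their sum
    \<open>w (u + u) 0\<close> and difference \<open>w 0 (v + v)\<close> have norm 2.\<close>
  proof (rule C_NJ_ge[of "w u v" _ "w u (- v)"])
    show "2 powr (1 - \<sigma> / s)
        = (dist_zero (psi_dist s d) (w u v + w u (- v)) powr \<sigma>
            + dist_zero (psi_dist s d) (w u v - w u (- v)) powr \<sigma>) /
          (2 powr (\<sigma> - 1) * (dist_zero (psi_dist s d) (w u v) powr \<sigma>
            + dist_zero (psi_dist s d) (w u (- v)) powr \<sigma>))"
      using le by (simp add: w_add w_diff fw u v u2 v2 vm zero powr_powr powr_diff)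
  qed (use u v mv nz w_in in auto)
  moreover have "C_NJ \<sigma> (prod_space X) (psi_dist s d) \<le> ereal (2 powr (\<sigma> / t - \<sigma> + 1))"
    by (rule upper)
      (simp only: dist_zero_psi_dist clarkson_on_prod_space_upper[OF le(1,2) cl'])
  ultimately show "C_NJ \<sigma> (prod_space X) (psi_dist s d) = ereal (2 powr (\<sigma> / t - \<sigma> + 1))"
    by (simp add: antisym)
qed

theorem corollary3:
  fixes X :: "'n::finite \<Rightarrow> 'a::real_vector set"
    and d :: "'n \<Rightarrow> 'a \<Rightarrow> 'a \<Rightarrow> real"
    and p q \<sigma> :: real
    and i j :: 'n
  assumes "CARD('n) \<ge> 2"
    and "\<And>k. subspace (X k)"
    and "\<And>k. X k \<noteq> {0}"
    and "\<And>k. Metric_space (X k) (d k)"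
    and "1 < p"
    and "1 / p + 1 / q = 1"
    and "i \<noteq> j"
    and "positively_homogeneous_on (X i) (dist_zero (d i))"
    and "absolutely_homogeneous_on (X j) (dist_zero (d j))"
    and "\<And>k. k \<noteq> i \<Longrightarrow> k \<noteq> j \<Longrightarrow> two_homogeneous_on (X k) (dist_zero (d k))"
    and "\<And>k. satisfies_clarkson_on (X k) (dist_zero (d k))"
  shows "(p \<le> 2 \<and> \<sigma> \<in> {p..q} \<longrightarrow>
            C_NJ \<sigma> (prod_space X) (psi_dist p d) = ereal (2 powr (\<sigma> / p - \<sigma> + 1)) \<and>
            C_NJ \<sigma> (prod_space X) (psi_dist q d) = ereal (2 powr (\<sigma> / p - \<sigma> + 1))) \<and>
         (2 < p \<and> \<sigma> \<in> {q..p} \<longrightarrow>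
            C_NJ \<sigma> (prod_space X) (psi_dist p d) = ereal (2 powr (1 - \<sigma> / p)) \<and>
            C_NJ \<sigma> (prod_space X) (psi_dist q d) = ereal (2 powr (1 - \<sigma> / p)))"
proof (intro conjI impI; (elim conjE)?)
  note X = assms(2,3) and d = assms(4) and hom = assms(7,8,9) and cl = assms(11)
  note main = C_NJ_psi_dist[where X = X and d = d, OF X d _ _ _ _ _ hom cl]
  {
    assume "p \<le> 2" "\<sigma> \<in> {p..q}"
    then show "C_NJ \<sigma> (prod_space X) (psi_dist p d) = ereal (2 powr (\<sigma> / p - \<sigma> + 1))"
      and "C_NJ \<sigma> (prod_space X) (psi_dist q d) = ereal (2 powr (\<sigma> / p - \<sigma> + 1))"
      using main[of p q \<sigma>] assms(5,6) by auto
  next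
    assume p: "2 < p" and \<sigma>: "\<sigma> \<in> {q..p}"
    \<comment> \<open>For \<open>p > 2\<close> the conjugate exponent \<open>q\<close> lies between
      1 and 2, so \<open>q\<close> takes the role of \<open>t\<close> and \<open>p\<close> that of
      \<open>s\<close>; conjugacy then rewrites the exponent in terms of \<open>p\<close>.\<close>
    have "0 < 1 / p" "1 / p < 1 / 2" using p by simp_all
    then have "1 / q < 1" "1 / 2 < 1 / q" using assms(6) by linarith+
    moreover from this have "0 < q" using zero_less_divide_1_iff[of q] by linarith
    ultimately have q: "1 < q" "q \<le> 2" by (simp_all add: field_simps)
    have "\<sigma> * (1 / p + 1 / q) = \<sigma>" using assms(6) by simp
    then have "\<sigma> / q - \<sigma> + 1 = 1 - \<sigma> / p" by (simp add: distrib_left)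
    then show "C_NJ \<sigma> (prod_space X) (psi_dist p d) = ereal (2 powr (1 - \<sigma> / p))"
      and "C_NJ \<sigma> (prod_space X) (psi_dist q d) = ereal (2 powr (1 - \<sigma> / p))"
      using main[of q p \<sigma>] q \<sigma> assms(6) by (auto simp: add.commute)
  }
qed

end
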